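(* Let $\mathcal{H}$ be a complex Hilbert space of finite dimension $N\ge 1$, and let $F=\{f_i\}_{i=1}^M$ be a frame for $\mathcal{H}$ with frame operator $S_F$. Let $p_1,\dots,p_M\in[0,1]$ be erasure probabilities with $p_i<\sum_{j=1}^M p_j$ for every $1\le i\le M$, and let $\{q_i\}_{i=1}^M$ be the weight number sequence $$q_i=\frac{\sum_{j=1}^M p_j}{\sum_{j=1}^M p_j-p_i}\cdot\frac{M-1}{N},\qquad 1\le i\le M.$$ Put $c=\max\{\sqrt{q_i}\,\|S_F^{-1/2}f_i\| : 1\le i\le M\}$, $$\Lambda_1=\{i\in\{1,\dots,M\} : \sqrt{q_i}\,\|S_F^{-1/2}f_i\|=c\},\qquad \Lambda_2=\{1,\dots,M\}\setminus\Lambda_1,$$ and $H_j=\operatorname{span}\{f_i : i\in\Lambda_j\}$ for $j=1,2$ (with $\operatorname{span}\emptyset=\{0\}$). If $H_1\cap H_2=\{0\}$, then the canonical dual $S_F^{-1}F=\{S_F^{-1}f_i\}_{i=1}^M$ is a $1$-erasure probability optimal dual of $F$ with respect to $\{q_i\}_{i=1}^M$; that is, for every dual frame $G=\{g_i\}_{i=1}^M$ of $F$, $$\max_{1\le i\le M} q_i\,|\langle f_i,S_F^{-1}f_i\rangle|\;\le\;\max_{1\le i\le M} q_i\,|\langle f_i,g_i\rangle|.$$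
   Context: A finite sequence $F=\{f_i\}_{i=1}^M$ in $\mathcal{H}$ is a frame if there are constants $A,B>0$ with $A\|f\|^2\le\sum_{i=1}^M|\langle f,f_i\rangle|^2\le B\|f\|^2$ for all $f\in\mathcal{H}$. Its frame operator $S_F:\mathcal{H}\to\mathcal{H}$, $S_Ff=\sum_{i=1}^M\langle f,f_i\rangle f_i$, is linear, positive, self-adjoint and invertible; $S_F^{-1/2}$ denotes the positive square root of $S_F^{-1}$. A sequence $G=\{g_i\}_{i=1}^M$ in $\mathcal{H}$ is a dual frame (dual) of $F$ if $f=\sum_{i=1}^M\langle f,f_i\rangle g_i=\sum_{i=1}^M\langle f,g_i\rangle f_i$ for every $f\in\mathcal{H}$. The sequence $S_F^{-1}F=\{S_F^{-1}f_i\}_{i=1}^M$ is a dual of $F$, called the canonical dual. For a dual $G$ of $F$, the probabilistic erasure error for $1$-erasure under the weight number sequence $\{q_i\}_{i=1}^M$ is $r_1^q(F,G)=\max_{1\le i\le M}q_i\,|\langle f_i,g_i\rangle|$. A dual $G$ of $F$ is called $1$-erasure probability optimal if it minimizes $r_1^q(F,\cdot)$ among all duals of $F$. *)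

theory Defs
  imports "HOL-Analysis.Analysis"
begin

text \<open>Complex Hilbert spaces. The inner product is linear in the first argument; the real vector
  space structure inherited from \<^class>\<open>real_normed_vector\<close> is tied to the complex one, so that
  \<^const>\<open>norm\<close> is the Hilbert space norm.\<close>

class complex_inner = real_normed_vector +
  fixes scaleC :: "complex \<Rightarrow> 'a \<Rightarrow> 'a"  (infixr \<open>*\<^sub>C\<close> 75)
    and cinner :: "'a \<Rightarrow> 'a \<Rightarrow> complex"
  assumes scaleC_add_right: "a *\<^sub>C (x + y) = a *\<^sub>C x + a *\<^sub>C y"
    and scaleC_add_left: "(a + b) *\<^sub>C x = a *\<^sub>C x + b *\<^sub>C x"
    and scaleC_scaleC: "a *\<^sub>C b *\<^sub>C x = (a * b) *\<^sub>C x"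
    and scaleC_one: "1 *\<^sub>C x = x"
    and scaleR_scaleC: "r *\<^sub>R x = complex_of_real r *\<^sub>C x"
    and cinner_commute: "cinner x y = cnj (cinner y x)"
    and cinner_add_left: "cinner (x + y) z = cinner x z + cinner y z"
    and cinner_scaleC_left: "cinner (a *\<^sub>C x) y = a * cinner x y"
    and cinner_ge_zero: "0 \<le> Re (cinner x x)"
    and cinner_eq_zero_iff: "cinner x x = 0 \<longleftrightarrow> x = 0"
    and norm_eq_sqrt_cinner: "norm x = sqrt (Re (cinner x x))"

class complex_hilbert = complex_inner + complete_space

global_interpretation complex_vector:
  vector_space "scaleC :: complex \<Rightarrow> 'a \<Rightarrow> 'a::complex_inner"
  by unfold_locales (simp_all add: scaleC_add_right scaleC_add_left scaleC_scaleC scaleC_one)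

text \<open>A finite sequence of length \<open>M\<close> is a function on \<^typ>\<open>nat\<close>, of which only the values at
  \<open>1, \<dots>, M\<close> matter.\<close>

definition is_frame :: "nat \<Rightarrow> (nat \<Rightarrow> 'a::complex_inner) \<Rightarrow> bool" where
  "is_frame M f \<longleftrightarrow> (\<exists>A>0. \<exists>B>0. \<forall>x.
     A * (norm x)\<^sup>2 \<le> (\<Sum>i=1..M. (cmod (cinner x (f i)))\<^sup>2) \<and>
     (\<Sum>i=1..M. (cmod (cinner x (f i)))\<^sup>2) \<le> B * (norm x)\<^sup>2)"

definition frame_operator :: "nat \<Rightarrow> (nat \<Rightarrow> 'a::complex_inner) \<Rightarrow> 'a \<Rightarrow> 'a" where
  "frame_operator M f x = (\<Sum>i=1..M. cinner x (f i) *\<^sub>C f i)"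

definition is_dual_frame ::
    "nat \<Rightarrow> (nat \<Rightarrow> 'a::complex_inner) \<Rightarrow> (nat \<Rightarrow> 'a) \<Rightarrow> bool" where
  "is_dual_frame M f g \<longleftrightarrow> (\<forall>x.
     x = (\<Sum>i=1..M. cinner x (f i) *\<^sub>C g i) \<and>
     x = (\<Sum>i=1..M. cinner x (g i) *\<^sub>C f i))"

definition canonical_dual :: "nat \<Rightarrow> (nat \<Rightarrow> 'a::complex_inner) \<Rightarrow> nat \<Rightarrow> 'a" where
  "canonical_dual M f i = inv (frame_operator M f) (f i)"

definition positive_operator :: "('a::complex_inner \<Rightarrow> 'a) \<Rightarrow> bool" where
  "positive_operator T \<longleftrightarrow> Vector_Spaces.linear scaleC scaleC T \<and>
     (\<forall>x y. cinner (T x) y = cinner x (T y)) \<and> (\<forall>x. 0 \<le> Re (cinner (T x) x))"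

definition positive_sqrt :: "('a::complex_inner \<Rightarrow> 'a) \<Rightarrow> 'a \<Rightarrow> 'a" where
  "positive_sqrt A = (THE T. positive_operator T \<and> T \<circ> T = A)"

definition erasure_error ::
    "nat \<Rightarrow> (nat \<Rightarrow> real) \<Rightarrow> (nat \<Rightarrow> 'a::complex_inner) \<Rightarrow> (nat \<Rightarrow> 'a) \<Rightarrow> real" where
  "erasure_error M q f g = Max ((\<lambda>i. q i * cmod (cinner (f i) (g i))) ` {1..M})"

definition erasure_optimal_dual ::
    "nat \<Rightarrow> (nat \<Rightarrow> real) \<Rightarrow> (nat \<Rightarrow> 'a::complex_inner) \<Rightarrow> (nat \<Rightarrow> 'a) \<Rightarrow> bool" where
  "erasure_optimal_dual M q f g \<longleftrightarrow> is_dual_frame M f g \<and>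
     (\<forall>h. is_dual_frame M f h \<longrightarrow> erasure_error M q f g \<le> erasure_error M q f h)"

definition weight_number :: "nat \<Rightarrow> nat \<Rightarrow> (nat \<Rightarrow> real) \<Rightarrow> nat \<Rightarrow> real" where
  "weight_number M N p i =
     (\<Sum>j=1..M. p j) / ((\<Sum>j=1..M. p j) - p i) * ((real M - 1) / real N)"

end

theory Submission
  imports Defs "HOL-Computational_Algebra.Fundamental_Theorem_Algebra"
begin

text \<open>Write \<open>S\<close> for the frame operator and \<open>k = S\<^sup>-\<^sup>1 f\<close> for the canonical dual.
  Since \<open>\<langle>f\<^sub>i, k\<^sub>i\<rangle> = \<parallel>S\<^sup>-\<^sup>1\<^sup>/\<^sup>2 f\<^sub>i\<parallel>\<^sup>2\<close>, the error of the canonical dual is \<open>c\<^sup>2\<close>, and it is attained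
  exactly on \<open>\<Lambda>1\<close>. It therefore suffices to find, for any other dual \<open>g\<close>, a single index
  \<open>i \<in> \<Lambda>1\<close> with \<open>Re \<langle>f\<^sub>i, g\<^sub>i\<rangle> \<ge> \<langle>f\<^sub>i, k\<^sub>i\<rangle>\<close>.

  Such an index exists because \<open>\<Sum>i\<in>\<Lambda>1. \<langle>f\<^sub>i, g\<^sub>i\<rangle>\<close> is the same for all duals
  (\<open>sum_cinner_eq_of_disjoint_spans\<close>). Indeed, with \<open>h = g - k\<close>, duality gives
  \<open>\<Sum>i. \<langle>x, h\<^sub>i\<rangle> f\<^sub>i = 0\<close> for every \<open>x\<close>; the part of the sum over \<open>\<Lambda>1\<close> is minus the part over
  \<open>\<Lambda>2\<close>, so it lies in \<open>H1 \<inter> H2\<close> and vanishes. Hence \<open>x \<mapsto> \<Sum>i\<in>\<Lambda>1. \<langle>x, h\<^sub>i\<rangle> f\<^sub>i\<close> is the zero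
  operator, and its trace, which is \<open>\<Sum>i\<in>\<Lambda>1. \<langle>f\<^sub>i, h\<^sub>i\<rangle>\<close>, is zero (\<open>trace_eq_zero\<close>).

  What remains is the operator theory behind \<open>S\<^sup>-\<^sup>1\<^sup>/\<^sup>2\<close>: the positive square root is defined by a
  definite description, so both existence and uniqueness are required. Both rest on the fact
  that the eigenvectors of a symmetric operator span the space (\<open>span_eigenvectors\<close>).\<close>

section \<open>Inner product calculus\<close>

lemma cinner_add_right: "cinner x (y + z) = cinner x y + cinner x z"
  by (metis cinner_add_left cinner_commute complex_cnj_add)

lemma cinner_scaleC_right: "cinner x (a *\<^sub>C y) = cnj a * cinner x y"
  by (metis cinner_commute cinner_scaleC_left complex_cnj_mult)

lemma cinner_zero_left [simp]: "cinner 0 x = 0"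
  using cinner_add_left[of 0 0 x] by simp

lemma cinner_zero_right [simp]: "cinner x 0 = 0"
  using cinner_add_right[of x 0 0] by simp

lemma cinner_diff_left: "cinner (x - y) z = cinner x z - cinner y z"
  using cinner_add_left[of "x - y" y z] by simp

lemma cinner_diff_right: "cinner x (y - z) = cinner x y - cinner x z"
  using cinner_add_right[of x "y - z" z] by simp

lemma cinner_minus_left: "cinner (- x) y = - cinner x y"
  using cinner_diff_left[of 0 x y] by simp

lemma cinner_sum_left: "cinner (\<Sum>i\<in>I. u i) x = (\<Sum>i\<in>I. cinner (u i) x)"
  by (induction I rule: infinite_finite_induct) (simp_all add: cinner_add_left)

lemma cinner_sum_right: "cinner x (\<Sum>i\<in>I. u i) = (\<Sum>i\<in>I. cinner x (u i))"
  by (induction I rule: infinite_finite_induct) (simp_all add: cinner_add_right)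

lemma cinner_self: "cinner x x = complex_of_real ((norm x)\<^sup>2)"
proof -
  have "Im (cinner x x) = 0"
    using arg_cong[OF cinner_commute[of x x], of Im] by simp
  then show ?thesis
    by (simp add: complex_eq_iff norm_eq_sqrt_cinner cinner_ge_zero)
qed

lemma cinner_eqI:
  assumes "\<And>z. cinner x z = cinner y z"
  shows "x = y"
proof -
  have "cinner (x - y) (x - y) = 0"
    by (simp add: cinner_diff_left assms)
  then show ?thesis
    by (simp add: cinner_eq_zero_iff)
qed

section \<open>Symmetric operators\<close>

locale symmetric_operator =
  fixes A :: "'a::complex_inner \<Rightarrow> 'a"
  assumes symmetric: "cinner (A x) y = cinner x (A y)"
begin

lemma add: "A (x + y) = A x + A y"
  by (rule cinner_eqI) (simp add: symmetric cinner_add_left)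

lemma scale: "A (a *\<^sub>C x) = a *\<^sub>C A x"
  by (rule cinner_eqI) (simp add: symmetric cinner_scaleC_left)

lemma zero [simp]: "A 0 = 0"
  by (rule cinner_eqI) (simp add: symmetric)

lemma diff: "A (x - y) = A x - A y"
  by (rule cinner_eqI) (simp add: symmetric cinner_diff_left)

lemma clinear: "Vector_Spaces.linear scaleC scaleC A"
  by (simp add: Vector_Spaces.linear_iff complex_vector.vector_space_axioms add scale)

lemma subspace_range: "complex_vector.subspace (range A)"
proof (rule complex_vector.subspaceI)
  show "0 \<in> range A"
    by (rule range_eqI[of _ _ 0]) simp
next
  fix x y assume "x \<in> range A" "y \<in> range A"
  then obtain u v where "x = A u" "y = A v"
    by blast
  then show "x + y \<in> range A"
    by (intro range_eqI[of _ _ "u + v"]) (simp add: add)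
next
  fix a x assume "x \<in> range A"
  then obtain u where "x = A u"
    by blast
  then show "a *\<^sub>C x \<in> range A"
    by (intro range_eqI[of _ _ "a *\<^sub>C u"]) (simp add: scale)
qed

lemma eigenvalue_real:
  assumes "A x = r *\<^sub>C x" and "x \<noteq> 0"
  shows "cnj r = r"
proof -
  have "r * cinner x x = cnj r * cinner x x"
    using symmetric[of x x] by (simp add: assms cinner_scaleC_left cinner_scaleC_right)
  then show ?thesis
    using assms(2) by (simp add: cinner_eq_zero_iff)
qed

lemma eigenvectors_orthogonal:
  assumes "A x = complex_of_real a *\<^sub>C x" and "A y = complex_of_real b *\<^sub>C y" and "a \<noteq> b"
  shows "cinner x y = 0"
  using symmetric[of x y] assms by (simp add: cinner_scaleC_left cinner_scaleC_right)

text \<open>Jordan blocks of size two are excluded: if \<open>w = (A - r) x\<close> is an eigenvector for \<open>r\<close>, then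
  \<open>\<langle>w, w\<rangle> = \<langle>(A - r) w, x\<rangle> = 0\<close> because \<open>r\<close> is real.\<close>

lemma generalized_eigenvector:
  assumes "A (A x - r *\<^sub>C x) = r *\<^sub>C (A x - r *\<^sub>C x)"
  shows "A x = r *\<^sub>C x"
proof (rule ccontr)
  define w where "w = A x - r *\<^sub>C x"
  assume "A x \<noteq> r *\<^sub>C x"
  then have "w \<noteq> 0"
    by (simp add: w_def)
  have w: "A w = r *\<^sub>C w"
    using assms by (simp add: w_def)
  have "cinner w w = cinner w (A x) - cnj r * cinner w x"
    by (subst (2) w_def) (simp add: cinner_diff_right cinner_scaleC_right)
  also have "cinner w (A x) = r * cinner w x"
    by (simp add: symmetric[symmetric] w cinner_scaleC_left)
  finally show False
    using eigenvalue_real[OF w \<open>w \<noteq> 0\<close>] \<open>w \<noteq> 0\<close> by (simp add: cinner_eq_zero_iff)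
qed

text \<open>Horner evaluation of the polynomial \<open>p\<close> at the operator \<open>A\<close>, applied to \<open>v\<close>.\<close>

definition poly_op :: "complex poly \<Rightarrow> 'a \<Rightarrow> 'a" where
  "poly_op p v = fold_coeffs (\<lambda>a w. a *\<^sub>C v + A w) p 0"

lemma poly_op_0 [simp]: "poly_op 0 v = 0"
  by (simp add: poly_op_def)

lemma poly_op_pCons [simp]: "poly_op (pCons a p) v = a *\<^sub>C v + A (poly_op p v)"
  by (cases "p = 0 \<and> a = 0") (auto simp: poly_op_def)

lemma poly_op_add: "poly_op (p + q) v = poly_op p v + poly_op q v"
  by (induction p q rule: poly_induct2)
    (simp_all add: add complex_vector.scale_left_distrib algebra_simps)

lemma poly_op_smult: "poly_op (smult a p) v = a *\<^sub>C poly_op p v"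
  by (induction p) (simp_all add: scale complex_vector.scale_right_distrib)

lemma poly_op_mult: "poly_op (p * q) v = poly_op p (poly_op q v)"
  by (induction p) (simp_all add: poly_op_add poly_op_smult)

lemma poly_op_sum: "poly_op (\<Sum>i\<in>I. p i) v = (\<Sum>i\<in>I. poly_op (p i) v)"
  by (induction I rule: infinite_finite_induct) (simp_all add: poly_op_add)

lemma poly_op_monom: "poly_op (monom a n) v = a *\<^sub>C (A ^^ n) v"
  by (induction n) (simp_all add: monom_0 monom_Suc scale)

lemma poly_op_diff_arg: "poly_op p (v - w) = poly_op p v - poly_op p w"
  by (induction p) (simp_all add: diff complex_vector.scale_right_diff_distrib)

lemma poly_op_scale_arg: "poly_op p (a *\<^sub>C v) = a *\<^sub>C poly_op p v"
  by (induction p) (simp_all add: scale complex_vector.scale_right_distrib mult.commute)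

lemma poly_op_eigenvector:
  assumes "A w = r *\<^sub>C w"
  shows "poly_op p w = poly p r *\<^sub>C w"
  by (induction p) (simp_all add: scale assms complex_vector.scale_left_distrib mult.commute)

text \<open>In finite dimension the vectors \<open>v, A v, A\<^sup>2 v, \<dots>\<close> either repeat or are linearly
  dependent; a repetition is treated apart because dependence is a notion for sets, in which
  repeated members of a family disappear.\<close>

lemma annihilating_polynomial:
  assumes "finite B" and "complex_vector.span B = (UNIV :: 'a set)"
  obtains p where "p \<noteq> 0" and "poly_op p v = 0"
proof (cases "inj (\<lambda>n. (A ^^ n) v)")
  case False
  then obtain m n where mn: "m \<noteq> n" "(A ^^ m) v = (A ^^ n) v"
    by (auto simp: inj_on_def)
  have "coeff (monom 1 m + monom (-1) n) m = (1 :: complex)"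
    using mn(1) by simp
  then have "monom 1 m + monom (-1) n \<noteq> (0 :: complex poly)"
    by (metis coeff_0 zero_neq_one)
  moreover have "poly_op (monom 1 m + monom (-1) n) v = 0"
    using mn(2) by (simp add: poly_op_add poly_op_monom)
  ultimately show ?thesis
    by (rule that)
next
  case True
  let ?w = "\<lambda>n. (A ^^ n) v"
  have "infinite (range ?w)"
    using True range_inj_infinite by blast
  then have "complex_vector.dependent (range ?w)"
    using complex_vector.independent_span_bound[OF assms(1)] assms(2) by blast
  then obtain S u where S: "finite S" "S \<subseteq> range ?w" "(\<Sum>x\<in>S. u x *\<^sub>C x) = 0" "\<exists>x\<in>S. u x \<noteq> 0"
    by (auto simp: complex_vector.dependent_explicit)
  define I where "I = ?w -` S"
  have I: "finite I" "S = ?w ` I"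
    using S(1,2) True by (auto simp: I_def finite_vimageI)
  define p where "p = (\<Sum>i\<in>I. monom (u (?w i)) i)"
  obtain k where k: "k \<in> I" "u (?w k) \<noteq> 0"
    using S(4) I(2) by auto
  have "coeff p k = u (?w k)"
    using I(1) k(1) by (simp add: p_def coeff_sum sum.delta)
  then have "p \<noteq> 0"
    using k(2) by auto
  moreover have "poly_op p v = 0"
  proof -
    have "poly_op p v = (\<Sum>i\<in>I. u (?w i) *\<^sub>C ?w i)"
      by (simp add: p_def poly_op_sum poly_op_monom)
    also have "\<dots> = (\<Sum>x\<in>S. u x *\<^sub>C x)"
      unfolding I(2) by (rule sum.reindex_cong[symmetric, of ?w]) (use True in \<open>auto intro: inj_on_subset\<close>)
    finally show ?thesis
      using S(3) by simp
  qed
  ultimately show ?thesis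
    by (rule that)
qed

text \<open>The zero vector is included, which makes the set convenient for spans.\<close>

definition eigenvectors :: "'a set" where
  "eigenvectors = {x. \<exists>a. A x = complex_of_real a *\<^sub>C x}"

text \<open>A root \<open>r\<close> of \<open>p = (X - r) q\<close> makes \<open>w = q(A) v\<close> an eigenvector (or zero). As \<open>r\<close> is not a
  root of \<open>q\<close> when \<open>w \<noteq> 0\<close>, subtracting a multiple of \<open>w\<close> from \<open>v\<close> gives a vector that is
  annihilated by \<open>q\<close>, and the degree has dropped.\<close>

lemma annihilated_in_span_eigenvectors:
  assumes "p \<noteq> 0" and "poly_op p v = 0"
  shows "v \<in> complex_vector.span eigenvectors"
  using assms
proof (induction "degree p" arbitrary: p v)
  case 0
  then obtain a where "p = [:a:]"
    by (metis degree_eq_zeroE)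
  with 0 show ?case
    by (simp add: complex_vector.span_zero)
next
  case (Suc n)
  obtain r where "poly p r = 0"
    using alg_closed_imp_poly_has_root[of p] Suc.hyps(2) by auto
  then obtain q where p: "p = [:- r, 1:] * q"
    by (auto simp: poly_eq_0_iff_dvd)
  have q: "q \<noteq> 0"
    using p Suc.prems(1) by auto
  have n: "n = degree q"
    using Suc.hyps(2) q unfolding p by (subst (asm) degree_mult_eq) auto
  define w where "w = poly_op q v"
  have "poly_op [:- r, 1:] w = 0"
    using Suc.prems(2) unfolding p w_def poly_op_mult .
  then have w: "A w = r *\<^sub>C w"
    by (simp add: add.commute)
  show ?case
  proof (cases "w = 0")
    case True
    then show ?thesis
      using Suc.hyps(1)[OF n q] by (simp add: w_def)
  next
    case False
    obtain a where "r = complex_of_real a"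
      using eigenvalue_real[OF w False] by (metis Reals_cases Reals_cnj_iff)
    then have "w \<in> eigenvectors"
      using w by (auto simp: eigenvectors_def)
    \<comment> \<open>A double root at \<open>r\<close> would make \<open>s(A) v\<close> a generalized eigenvector that is not an
      eigenvector.\<close>
    have "poly q r \<noteq> 0"
    proof
      assume "poly q r = 0"
      then obtain s where s: "q = [:- r, 1:] * s"
        by (auto simp: poly_eq_0_iff_dvd)
      have "w = A (poly_op s v) - r *\<^sub>C poly_op s v"
        unfolding w_def s poly_op_mult by simp
      then show False
        using generalized_eigenvector[of "poly_op s v" r] w False by simp
    qed
    \<comment> \<open>The factor is chosen for \<open>q(A) u = w - q(r)\<^sup>-\<^sup>1 q(A) w = 0\<close>.\<close>
    define u where "u = v - inverse (poly q r) *\<^sub>C w"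
    have "poly_op q u = 0"
      using \<open>poly q r \<noteq> 0\<close>
      by (simp add: u_def poly_op_diff_arg poly_op_scale_arg poly_op_eigenvector[OF w] flip: w_def)
    then have "u \<in> complex_vector.span eigenvectors"
      using Suc.hyps(1)[OF n q] by simp
    then have "u + inverse (poly q r) *\<^sub>C w \<in> complex_vector.span eigenvectors"
      using \<open>w \<in> eigenvectors\<close>
      by (simp add: complex_vector.span_add complex_vector.span_scale complex_vector.span_base)
    then show ?thesis
      by (simp add: u_def)
  qed
qed

lemma span_eigenvectors:
  assumes "finite B" and "complex_vector.span B = (UNIV :: 'a set)"
  shows "complex_vector.span eigenvectors = UNIV"
proof -
  have "v \<in> complex_vector.span eigenvectors" for v
    by (rule annihilating_polynomial[OF assms, of v]) (rule annihilated_in_span_eigenvectors)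
  then show ?thesis
    by auto
qed

lemma eigenbasis:
  assumes "finite B" and "complex_vector.span B = (UNIV :: 'a set)"
  obtains E l where "complex_vector.independent E" and "complex_vector.span E = UNIV"
    and "\<And>b. b \<in> E \<Longrightarrow> A b = complex_of_real (l b) *\<^sub>C b"
proof -
  obtain E where E: "E \<subseteq> eigenvectors" "complex_vector.independent E"
      "eigenvectors \<subseteq> complex_vector.span E"
    using complex_vector.maximal_independent_subset by blast
  have "complex_vector.span E = UNIV"
    using complex_vector.span_minimal[OF E(3)] span_eigenvectors[OF assms] by auto
  moreover have "\<forall>b\<in>E. \<exists>a. A b = complex_of_real a *\<^sub>C b"
    using E(1) by (auto simp: eigenvectors_def)
  from bchoice[OF this] obtain l where "\<forall>b\<in>E. A b = complex_of_real (l b) *\<^sub>C b"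
    by blast
  ultimately show ?thesis
    using that[OF E(2), of l] by blast
qed

text \<open>Surjectivity needs no dimension count: the eigenvalues are nonzero, so the range
  contains all eigenvectors, and these span.\<close>

lemma bij_if_positive_definite:
  assumes "finite B" and "complex_vector.span B = (UNIV :: 'a set)"
    and pos: "\<And>x. x \<noteq> 0 \<Longrightarrow> 0 < Re (cinner (A x) x)"
  shows "bij A"
proof (rule bijI)
  show "inj A"
  proof (rule injI)
    fix x y assume "A x = A y"
    then have "cinner (A (x - y)) (x - y) = 0"
      by (simp add: diff)
    then show "x = y"
      using pos[of "x - y"] by (cases "x = y") auto
  qed
  have "eigenvectors \<subseteq> range A"
  proof
    fix x assume "x \<in> eigenvectors"
    then obtain a where a: "A x = complex_of_real a *\<^sub>C x"
      by (auto simp: eigenvectors_def)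
    show "x \<in> range A"
    proof (cases "x = 0")
      case True
      then show ?thesis
        by (intro range_eqI[of _ _ 0]) simp
    next
      case False
      then have "a \<noteq> 0"
        using pos[of x] by (auto simp: a)
      then have "x = A (complex_of_real (inverse a) *\<^sub>C x)"
        by (simp add: scale a)
      then show ?thesis
        by (rule range_eqI)
    qed
  qed
  then have sub: "complex_vector.span eigenvectors \<subseteq> range A"
    by (rule complex_vector.span_minimal) (rule subspace_range)
  have all: "complex_vector.span eigenvectors = UNIV"
    by (rule span_eigenvectors[OF assms(1,2)])
  show "surj A"
    using sub by (simp only: all top_unique)
qed

lemma symmetric_operator_inv:
  assumes "bij A"
  shows "symmetric_operator (inv A)"
proof
  fix x y
  have "A (inv A z) = z" for z
    using assms by (simp add: bij_is_surj surj_f_inv_f)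
  then show "cinner (inv A x) y = cinner x (inv A y)"
    using symmetric[of "inv A x" "inv A y"] by simp
qed

end

lemma symmetric_operator_eqI:
  assumes "symmetric_operator S" and "symmetric_operator T"
    and "complex_vector.span X = UNIV" and "\<And>x. x \<in> X \<Longrightarrow> S x = T x"
  shows "S = T"
proof
  fix x
  interpret S: symmetric_operator S by fact
  interpret T: symmetric_operator T by fact
  have "x \<in> complex_vector.span X"
    using assms(3) by simp
  then show "S x = T x"
    by (induction x rule: complex_vector.span_induct_alt)
      (simp_all add: S.add T.add S.scale T.scale assms(4))
qed

lemma cinner_eqI_spanning:
  assumes "complex_vector.span X = UNIV" and "\<And>z. z \<in> X \<Longrightarrow> cinner x z = cinner y z"
  shows "x = y"
proof (rule cinner_eqI)
  fix z :: 'a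
  have "z \<in> complex_vector.span X"
    using assms(1) by simp
  then show "cinner x z = cinner y z"
    by (induction z rule: complex_vector.span_induct_alt)
      (simp_all add: assms(2) cinner_add_right cinner_scaleC_right)
qed

section \<open>Functional calculus and the positive square root\<close>

text \<open>\<open>R = \<phi>(A)\<close> is defined on a basis of eigenvectors that need not be orthogonal. It is symmetric
  because basis vectors for different eigenvalues are orthogonal, while on those for the same
  eigenvalue \<open>R\<close> is the same scalar. Pairing with the basis in the same way shows that \<open>R\<close> acts as
  \<open>\<phi> a\<close> on every eigenvector for \<open>a\<close>, not only on the chosen ones.\<close>

lemma (in symmetric_operator) functional_calculus:
  fixes \<phi> :: "real \<Rightarrow> real"
  assumes "finite B" and "complex_vector.span B = (UNIV :: 'a set)"
  obtains R where "symmetric_operator R"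
    and "\<And>a v. A v = complex_of_real a *\<^sub>C v \<Longrightarrow> R v = complex_of_real (\<phi> a) *\<^sub>C v"
proof -
  obtain E l where E: "complex_vector.independent E" "complex_vector.span E = UNIV"
    and l: "\<And>b. b \<in> E \<Longrightarrow> A b = complex_of_real (l b) *\<^sub>C b"
    using eigenbasis[OF assms] by blast
  interpret pair: vector_space_pair "scaleC :: complex \<Rightarrow> 'a \<Rightarrow> 'a" "scaleC :: complex \<Rightarrow> 'a \<Rightarrow> 'a"
    by unfold_locales
  define R where "R = pair.construct E (\<lambda>b. complex_of_real (\<phi> (l b)) *\<^sub>C b)"
  have lin: "Vector_Spaces.linear scaleC scaleC R"
    unfolding R_def by (rule pair.linear_construct[OF E(1)])
  have R_add: "R (x + y) = R x + R y" and R_scale: "R (a *\<^sub>C x) = a *\<^sub>C R x" for a x y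
    using lin by (simp_all add: Vector_Spaces.linear_iff)
  have R_zero: "R 0 = 0"
    using R_scale[of 0 0] by simp
  have R_basis: "R b = complex_of_real (\<phi> (l b)) *\<^sub>C b" if "b \<in> E" for b
    unfolding R_def using E(1) that by (rule pair.construct_basis)
  have basis: "cinner (complex_of_real (\<phi> a) *\<^sub>C v) b = cinner v (R b)"
    if "A v = complex_of_real a *\<^sub>C v" "b \<in> E" for a v b
    using eigenvectors_orthogonal[OF that(1) l[OF that(2)]] that(2)
    by (cases "l b = a") (simp_all add: R_basis cinner_scaleC_left cinner_scaleC_right)
  have "symmetric_operator R"
  proof
    fix x y
    have one: "cinner (R b) y = cinner b (R y)" if "b \<in> E" for b
    proof -
      have "y \<in> complex_vector.span E"
        using E(2) by simp
      then show ?thesis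
        by (induction y rule: complex_vector.span_induct_alt)
          (simp_all add: R_add R_scale R_zero R_basis[OF that] basis[OF l[OF that]]
            cinner_add_right cinner_scaleC_right)
    qed
    have "x \<in> complex_vector.span E"
      using E(2) by simp
    then show "cinner (R x) y = cinner x (R y)"
      by (induction x rule: complex_vector.span_induct_alt)
        (simp_all add: R_add R_scale R_zero one cinner_add_left cinner_scaleC_left)
  qed
  moreover have "R v = complex_of_real (\<phi> a) *\<^sub>C v" if "A v = complex_of_real a *\<^sub>C v" for a v
    using symmetric_operator.symmetric[OF calculation, of v] basis[OF that]
    by (intro cinner_eqI_spanning[OF E(2)]) simp
  ultimately show ?thesis
    by (rule that)
qed

lemma positive_operator_symmetric: "positive_operator T \<Longrightarrow> symmetric_operator T"
  by (simp add: positive_operator_def symmetric_operator_def)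

text \<open>Squaring a symmetric fourth root, rather than taking a square root directly, gives positivity
  at once from \<open>\<langle>R (R x), x\<rangle> = \<parallel>R x\<parallel>\<^sup>2\<close>.\<close>

lemma positive_sqrt_exists:
  assumes "finite B" and "complex_vector.span B = (UNIV :: 'a::complex_inner set)"
    and pos: "positive_operator (A :: 'a \<Rightarrow> 'a)"
  obtains T where "positive_operator T" and "T \<circ> T = A"
proof -
  interpret A: symmetric_operator A
    using pos by (rule positive_operator_symmetric)
  obtain R where R: "symmetric_operator R"
    and R_eigen: "\<And>a v. A v = complex_of_real a *\<^sub>C v \<Longrightarrow> R v = complex_of_real (root 4 a) *\<^sub>C v"
    using A.functional_calculus[OF assms(1,2)] by blast
  interpret R: symmetric_operator R
    by (rule R)
  interpret R2: symmetric_operator "R \<circ> R"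
    by unfold_locales (simp add: R.symmetric)
  interpret R4: symmetric_operator "(R \<circ> R) \<circ> (R \<circ> R)"
    by unfold_locales (simp add: R.symmetric)
  have "0 \<le> Re (cinner ((R \<circ> R) x) x)" for x
    using cinner_ge_zero[of "R x"] by (simp add: R.symmetric)
  then have "positive_operator (R \<circ> R)"
    unfolding positive_operator_def using R2.clinear R2.symmetric by blast
  moreover have "(R \<circ> R) \<circ> (R \<circ> R) = A"
  proof (rule symmetric_operator_eqI[OF R4.symmetric_operator_axioms A.symmetric_operator_axioms
        A.span_eigenvectors[OF assms(1,2)]])
    fix v assume "v \<in> A.eigenvectors"
    then obtain a where a: "A v = complex_of_real a *\<^sub>C v"
      by (auto simp: A.eigenvectors_def)
    show "((R \<circ> R) \<circ> (R \<circ> R)) v = A v"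
    proof (cases "v = 0")
      case True
      then show ?thesis by simp
    next
      case False
      have "0 \<le> a * (norm v)\<^sup>2"
        using pos by (simp add: positive_operator_def)
          (metis a Re_complex_of_real cinner_scaleC_left cinner_self of_real_mult)
      then have "0 \<le> a"
        using False by (simp add: zero_le_mult_iff)
      then have "root 4 a * (root 4 a * (root 4 a * root 4 a)) = a"
        using real_root_pow_pos2[of 4 a] by (simp add: power4_eq_xxxx mult.assoc)
      then show ?thesis
        by (simp add: a R_eigen[OF a] R.scale scaleC_scaleC flip: of_real_mult)
    qed
  qed
  ultimately show ?thesis
    by (rule that)
qed

text \<open>It suffices to compare the two roots on an eigenvector \<open>T v = t v\<close>. From
  \<open>(S + t) (S - t) v = (S\<^sup>2 - t\<^sup>2) v = 0\<close>, the vector \<open>w = (S - t) v\<close> satisfies \<open>S w = - t w\<close>, and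
  positivity of \<open>S\<close> forces \<open>w = 0\<close> if \<open>t > 0\<close>. If \<open>t = 0\<close>, then
  \<open>\<parallel>S v\<parallel>\<^sup>2 = \<langle>S (S v), v\<rangle> = 0\<close>.\<close>

lemma positive_sqrt_unique:
  assumes "finite B" and "complex_vector.span B = (UNIV :: 'a::complex_inner set)"
    and T: "positive_operator (T :: 'a \<Rightarrow> 'a)" and S: "positive_operator S" and eq: "S \<circ> S = T \<circ> T"
  shows "S = T"
proof -
  interpret T: symmetric_operator T
    using T by (rule positive_operator_symmetric)
  interpret S: symmetric_operator S
    using S by (rule positive_operator_symmetric)
  show ?thesis
  proof (rule symmetric_operator_eqI[OF S.symmetric_operator_axioms T.symmetric_operator_axioms
        T.span_eigenvectors[OF assms(1,2)]])
    fix v assume "v \<in> T.eigenvectors"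
    then obtain t where t: "T v = complex_of_real t *\<^sub>C v"
      by (auto simp: T.eigenvectors_def)
    have SS: "S (S v) = complex_of_real (t * t) *\<^sub>C v"
      using fun_cong[OF eq, of v] by (simp add: t T.scale scaleC_scaleC)
    show "S v = T v"
    proof (cases "v = 0")
      case True
      then show ?thesis by simp
    next
      case False
      have "0 \<le> t * (norm v)\<^sup>2"
        using T by (simp add: positive_operator_def)
          (metis t Re_complex_of_real cinner_scaleC_left cinner_self of_real_mult)
      then have "0 \<le> t"
        using False by (simp add: zero_le_mult_iff)
      define w where "w = S v - complex_of_real t *\<^sub>C v"
      have Sw: "S w = complex_of_real (- t) *\<^sub>C w"
        by (simp add: w_def S.diff S.scale SS scaleC_scaleC complex_vector.scale_right_diff_distrib)
      have "w = 0"
      proof (cases "t = 0")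
        case True
        then have "cinner w w = 0"
          by (simp add: w_def S.symmetric SS)
        then show ?thesis
          by (simp add: cinner_eq_zero_iff)
      next
        case False
        have "0 \<le> Re (cinner (S w) w)"
          using S unfolding positive_operator_def by blast
        then have "t * (norm w)\<^sup>2 \<le> 0"
          by (simp add: Sw cinner_minus_left cinner_scaleC_left cinner_self)
        then show ?thesis
          using False \<open>0 \<le> t\<close> by (simp add: mult_le_0_iff)
      qed
      then show ?thesis
        by (simp add: w_def t)
    qed
  qed
qed

lemma positive_sqrt:
  assumes "finite B" and "complex_vector.span B = (UNIV :: 'a::complex_inner set)"
    and "positive_operator (A :: 'a \<Rightarrow> 'a)"
  shows "positive_operator (positive_sqrt A)" and "positive_sqrt A \<circ> positive_sqrt A = A"
proof -
  obtain T where T: "positive_operator T" "T \<circ> T = A"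
    using positive_sqrt_exists[OF assms] by blast
  have "positive_operator (positive_sqrt A) \<and> positive_sqrt A \<circ> positive_sqrt A = A"
    unfolding positive_sqrt_def
  proof (rule theI[of _ T])
    show "positive_operator T \<and> T \<circ> T = A"
      using T ..
    fix S assume "positive_operator S \<and> S \<circ> S = A"
    then show "S = T"
      by (intro positive_sqrt_unique[OF assms(1,2) T(1)]) (simp_all add: T(2))
  qed
  then show "positive_operator (positive_sqrt A)" "positive_sqrt A \<circ> positive_sqrt A = A"
    by auto
qed

lemma norm_positive_sqrt:
  assumes "finite B" and "complex_vector.span B = (UNIV :: 'a::complex_inner set)"
    and "positive_operator (A :: 'a \<Rightarrow> 'a)"
  shows "complex_of_real ((norm (positive_sqrt A x))\<^sup>2) = cinner x (A x)"
proof -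
  interpret symmetric_operator "positive_sqrt A"
    using positive_sqrt(1)[OF assms] by (rule positive_operator_symmetric)
  show ?thesis
    using fun_cong[OF positive_sqrt(2)[OF assms], of x]
    by (simp only: symmetric o_def flip: cinner_self)
qed

section \<open>Frames and their duals\<close>

lemma symmetric_frame_operator: "symmetric_operator (frame_operator M f)"
proof
  fix x y
  have "cinner (f i) y = cnj (cinner y (f i))" for i
    by (rule cinner_commute)
  then show "cinner (frame_operator M f x) y = cinner x (frame_operator M f y)"
    by (simp add: frame_operator_def cinner_sum_left cinner_sum_right cinner_scaleC_left
      cinner_scaleC_right mult.commute)
qed

lemma cinner_frame_operator:
  "cinner (frame_operator M f x) x = complex_of_real (\<Sum>i=1..M. (cmod (cinner x (f i)))\<^sup>2)"
proof -
  have "cinner x (f i) * cinner (f i) x = complex_of_real ((cmod (cinner x (f i)))\<^sup>2)" for i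
    by (subst (2) cinner_commute) (simp only: complex_norm_square)
  then show ?thesis
    by (simp add: frame_operator_def cinner_sum_left cinner_scaleC_left)
qed

lemma bij_frame_operator:
  assumes "finite B" and "complex_vector.span B = (UNIV :: 'a::complex_inner set)"
    and "is_frame M (f :: nat \<Rightarrow> 'a)"
  shows "bij (frame_operator M f)"
proof (rule symmetric_operator.bij_if_positive_definite[OF symmetric_frame_operator assms(1,2)])
  fix x :: 'a assume "x \<noteq> 0"
  obtain a where a: "a > 0" "a * (norm x)\<^sup>2 \<le> (\<Sum>i=1..M. (cmod (cinner x (f i)))\<^sup>2)"
    using assms(3) unfolding is_frame_def by blast
  have "0 < a * (norm x)\<^sup>2"
    using a(1) \<open>x \<noteq> 0\<close> by simp
  with a(2) show "0 < Re (cinner (frame_operator M f x) x)"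
    by (simp only: cinner_frame_operator Re_complex_of_real)
qed

lemma positive_inv_frame_operator:
  assumes "bij (frame_operator M f)"
  shows "positive_operator (inv (frame_operator M f))"
proof -
  let ?S = "frame_operator M f"
  interpret inv: symmetric_operator "inv ?S"
    using symmetric_operator.symmetric_operator_inv[OF symmetric_frame_operator assms] .
  have "0 \<le> Re (cinner (inv ?S x) x)" for x
  proof -
    have "cinner (inv ?S x) x = cinner (?S (inv ?S x)) (inv ?S x)"
      using assms by (simp add: bij_is_surj surj_f_inv_f inv.symmetric)
    then show ?thesis
      by (simp add: cinner_frame_operator sum_nonneg)
  qed
  then show ?thesis
    using inv.clinear inv.symmetric by (simp add: positive_operator_def)
qed

lemma canonical_dual_is_dual:
  assumes "bij (frame_operator M f)"
  shows "is_dual_frame M f (canonical_dual M f)"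
  unfolding is_dual_frame_def
proof (intro allI conjI)
  fix x
  let ?S = "frame_operator M f"
  interpret inv: symmetric_operator "inv ?S"
    using symmetric_operator.symmetric_operator_inv[OF symmetric_frame_operator assms] .
  have sum: "inv ?S (\<Sum>i\<in>I. u i) = (\<Sum>i\<in>I. inv ?S (u i))" for I and u :: "nat \<Rightarrow> 'a"
    by (induction I rule: infinite_finite_induct) (simp_all add: inv.add)
  have "x = inv ?S (?S x)"
    using assms by (simp add: bij_is_inj)
  also have "?S x = (\<Sum>i=1..M. cinner x (f i) *\<^sub>C f i)"
    by (rule frame_operator_def)
  finally show "x = (\<Sum>i=1..M. cinner x (f i) *\<^sub>C canonical_dual M f i)"
    by (simp add: canonical_dual_def sum inv.scale)
  have "x = ?S (inv ?S x)"
    using assms by (simp add: bij_is_surj surj_f_inv_f)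
  also have "\<dots> = (\<Sum>i=1..M. cinner (inv ?S x) (f i) *\<^sub>C f i)"
    by (rule frame_operator_def)
  finally show "x = (\<Sum>i=1..M. cinner x (canonical_dual M f i) *\<^sub>C f i)"
    by (simp only: canonical_dual_def inv.symmetric)
qed

text \<open>The left-hand side is the trace of the operator \<open>T x = \<Sum>i\<in>I. \<langle>x, h\<^sub>i\<rangle> f\<^sub>i\<close>, which is assumed
  to vanish. A dual pair serves in place of an orthonormal basis: the trace is
  also \<open>\<Sum>j. \<langle>T f\<^sub>j, k\<^sub>j\<rangle>\<close>.\<close>

lemma trace_eq_zero:
  assumes "is_dual_frame M f k" and "\<And>x. (\<Sum>i\<in>I. cinner x (h i) *\<^sub>C f i) = 0"
  shows "(\<Sum>i\<in>I. cinner (f i) (h i)) = 0"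
proof -
  have "cinner (f i) (h i) = (\<Sum>j=1..M. cinner (f i) (k j) * cinner (f j) (h i))" for i
  proof -
    have "f i = (\<Sum>j=1..M. cinner (f i) (k j) *\<^sub>C f j)"
      using assms(1) unfolding is_dual_frame_def by blast
    then have "cinner (f i) (h i) = cinner (\<Sum>j=1..M. cinner (f i) (k j) *\<^sub>C f j) (h i)"
      by (rule arg_cong)
    then show ?thesis
      by (simp add: cinner_sum_left cinner_scaleC_left)
  qed
  then have "(\<Sum>i\<in>I. cinner (f i) (h i)) =
      (\<Sum>i\<in>I. \<Sum>j=1..M. cinner (f i) (k j) * cinner (f j) (h i))"
    by simp
  also have "\<dots> = (\<Sum>j=1..M. \<Sum>i\<in>I. cinner (f i) (k j) * cinner (f j) (h i))"
    by (rule sum.swap)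
  also have "\<dots> = (\<Sum>j=1..M. cinner (\<Sum>i\<in>I. cinner (f j) (h i) *\<^sub>C f i) (k j))"
    by (simp add: cinner_sum_left cinner_scaleC_left mult.commute)
  also have "\<dots> = 0"
    by (simp add: assms(2))
  finally show ?thesis .
qed

text \<open>The operators \<open>x \<mapsto> \<Sum>i\<in>I. \<langle>x, g\<^sub>i\<rangle> f\<^sub>i\<close> and \<open>x \<mapsto> \<Sum>i\<in>I. \<langle>x, k\<^sub>i\<rangle> f\<^sub>i\<close> coincide, since their
  difference takes values in both spans; the two sums are the traces of these operators.\<close>

lemma sum_cinner_eq_of_disjoint_spans:
  assumes g: "is_dual_frame M f g" and k: "is_dual_frame M f k" and I: "I \<subseteq> {1..M}"
    and disj: "complex_vector.span (f ` I) \<inter> complex_vector.span (f ` ({1..M} - I)) = {0}"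
  shows "(\<Sum>i\<in>I. cinner (f i) (g i)) = (\<Sum>i\<in>I. cinner (f i) (k i))"
proof -
  define h where "h = (\<lambda>i. g i - k i)"
  have "(\<Sum>i\<in>I. cinner x (h i) *\<^sub>C f i) = 0" for x
  proof -
    let ?u = "\<lambda>J. \<Sum>i\<in>J. cinner x (h i) *\<^sub>C f i"
    have "x = (\<Sum>i=1..M. cinner x (g i) *\<^sub>C f i)" "x = (\<Sum>i=1..M. cinner x (k i) *\<^sub>C f i)"
      using g k unfolding is_dual_frame_def by blast+
    then have "?u {1..M} = x - x"
      by (simp add: h_def cinner_diff_right complex_vector.scale_left_diff_distrib sum_subtractf)
    then have "?u I + ?u ({1..M} - I) = 0"
      using sum.subset_diff[OF I, of "\<lambda>i. cinner x (h i) *\<^sub>C f i"] by (simp add: add.commute)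
    then have neg: "?u I = - ?u ({1..M} - I)"
      by (simp add: eq_neg_iff_add_eq_0)
    have mem: "?u J \<in> complex_vector.span (f ` J)" for J
      by (intro complex_vector.span_sum complex_vector.span_scale complex_vector.span_base imageI)
    have "?u I \<in> complex_vector.span (f ` ({1..M} - I))"
      unfolding neg by (intro complex_vector.span_neg mem)
    then show ?thesis
      using mem[of I] disj by blast
  qed
  then have "(\<Sum>i\<in>I. cinner (f i) (h i)) = 0"
    by (rule trace_eq_zero[OF k])
  then show ?thesis
    by (simp add: h_def cinner_diff_right sum_subtractf)
qed

lemma weight_number_nonneg:
  assumes "\<And>i. i \<in> {1..M} \<Longrightarrow> 0 \<le> p i" and "p i < (\<Sum>j=1..M. p j)" and "i \<in> {1..M}"
  shows "0 \<le> weight_number M N p i"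
  unfolding weight_number_def
  using assms(2,3) sum_nonneg[of "{1..M}" p, OF assms(1)]
  by (intro mult_nonneg_nonneg divide_nonneg_nonneg) auto

theorem theorem3p1:
  fixes f :: "nat \<Rightarrow> 'a::complex_hilbert"
    and p q :: "nat \<Rightarrow> real"
    and M N :: nat
    and c :: real
    and \<Lambda>1 \<Lambda>2 :: "nat set"
    and H1 H2 :: "'a set"
  assumes fin_dim: "\<exists>B :: 'a set. finite B \<and> complex_vector.span B = UNIV"
    and dim: "complex_vector.dim (UNIV :: 'a set) = N"
    and N: "N \<ge> 1"
    and frame: "is_frame M f"
    and p_prob: "\<And>i. i \<in> {1..M} \<Longrightarrow> 0 \<le> p i \<and> p i \<le> 1"
    and p_less: "\<And>i. i \<in> {1..M} \<Longrightarrow> p i < (\<Sum>j=1..M. p j)"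
  defines "q \<equiv> weight_number M N p"
  defines "c \<equiv> Max ((\<lambda>i. sqrt (q i) * norm (positive_sqrt (inv (frame_operator M f)) (f i))) ` {1..M})"
  defines "\<Lambda>1 \<equiv> {i \<in> {1..M}. sqrt (q i) * norm (positive_sqrt (inv (frame_operator M f)) (f i)) = c}"
  defines "\<Lambda>2 \<equiv> {1..M} - \<Lambda>1"
  defines "H1 \<equiv> complex_vector.span (f ` \<Lambda>1)"
  defines "H2 \<equiv> complex_vector.span (f ` \<Lambda>2)"
  assumes H_disjoint: "H1 \<inter> H2 = {0}"
  shows "erasure_optimal_dual M q f (canonical_dual M f)"
proof -
  obtain B where B: "finite B" "complex_vector.span B = (UNIV :: 'a set)"
    using fin_dim by blast
  let ?k = "canonical_dual M f"
  have bij: "bij (frame_operator M f)"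
    using B frame by (rule bij_frame_operator)
  have k: "is_dual_frame M f ?k"
    using bij by (rule canonical_dual_is_dual)
  have M: "{1..M} \<noteq> {}"
  proof
    assume "{1..M} = {}"
    then have "x = 0" for x :: 'a
      using k unfolding is_dual_frame_def by (metis sum.empty)
    then have "UNIV \<subseteq> complex_vector.span ({} :: 'a set)"
      by auto
    then show False
      using complex_vector.dim_le_card[of UNIV "{} :: 'a set"] dim N by simp
  qed
  have q: "0 \<le> q i" if "i \<in> {1..M}" for i
    unfolding q_def using p_prob p_less that by (intro weight_number_nonneg) auto
  define s where "s = (\<lambda>i. norm (positive_sqrt (inv (frame_operator M f)) (f i)))"
  have s: "cinner (f i) (?k i) = complex_of_real ((s i)\<^sup>2)" for i
    unfolding s_def canonical_dual_def
    by (rule norm_positive_sqrt[OF B positive_inv_frame_operator[OF bij], symmetric])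
  have sq: "q i * cmod (cinner (f i) (?k i)) = (sqrt (q i) * s i)\<^sup>2" if "i \<in> {1..M}" for i
    using q[OF that] by (simp add: s norm_power power_mult_distrib)
  have c: "c = Max ((\<lambda>i. sqrt (q i) * s i) ` {1..M})" and L: "\<Lambda>1 = {i \<in> {1..M}. sqrt (q i) * s i = c}"
    by (simp_all add: c_def \<Lambda>1_def s_def)
  have "c \<in> (\<lambda>i. sqrt (q i) * s i) ` {1..M}"
    unfolding c using M by (intro Max_in) auto
  then have "\<Lambda>1 \<noteq> {}"
    by (auto simp: L)
  have "erasure_error M q f ?k \<le> c\<^sup>2"
    unfolding erasure_error_def
  proof (rule Max.boundedI)
    fix a assume "a \<in> (\<lambda>i. q i * cmod (cinner (f i) (?k i))) ` {1..M}"
    then obtain i where i: "i \<in> {1..M}" "a = (sqrt (q i) * s i)\<^sup>2"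
      using sq by auto
    have "sqrt (q i) * s i \<le> c"
      unfolding c using i(1) by (intro Max_ge) auto
    then show "a \<le> c\<^sup>2"
      unfolding i(2) using q[OF i(1)] by (intro power_mono) (simp_all add: s_def)
  qed (use M in auto)
  moreover have "c\<^sup>2 \<le> erasure_error M q f g" if g: "is_dual_frame M f g" for g
  proof -
    have "\<Lambda>1 \<subseteq> {1..M}" "finite \<Lambda>1"
      by (auto simp: L)
    then have "(\<Sum>i\<in>\<Lambda>1. cinner (f i) (g i)) = (\<Sum>i\<in>\<Lambda>1. cinner (f i) (?k i))"
      using H_disjoint unfolding H1_def H2_def \<Lambda>2_def
      by (intro sum_cinner_eq_of_disjoint_spans[OF g k])
    then have "(\<Sum>i\<in>\<Lambda>1. Re (cinner (f i) (g i))) = (\<Sum>i\<in>\<Lambda>1. (s i)\<^sup>2)"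
      by (simp only: s Re_complex_of_real flip: Re_sum of_real_sum)
    moreover have "(\<Sum>i\<in>\<Lambda>1. Re (cinner (f i) (g i))) < (\<Sum>i\<in>\<Lambda>1. (s i)\<^sup>2)"
      if "\<And>i. i \<in> \<Lambda>1 \<Longrightarrow> Re (cinner (f i) (g i)) < (s i)\<^sup>2"
      using \<open>finite \<Lambda>1\<close> \<open>\<Lambda>1 \<noteq> {}\<close> that by (rule sum_strict_mono)
    \<comment> \<open>Equal sums cannot have all terms strictly ordered in the same direction.\<close>
    ultimately obtain i where i: "i \<in> \<Lambda>1" "(s i)\<^sup>2 \<le> Re (cinner (f i) (g i))"
      by (metis not_less order.irrefl)
    have iM: "i \<in> {1..M}" and ci: "sqrt (q i) * s i = c"
      using i(1) by (auto simp: L)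
    have "c\<^sup>2 = q i * (s i)\<^sup>2"
      using q[OF iM] by (simp add: power_mult_distrib flip: ci)
    also have "\<dots> \<le> q i * cmod (cinner (f i) (g i))"
      using i(2) complex_Re_le_cmod[of "cinner (f i) (g i)"] q[OF iM] by (intro mult_left_mono) auto
    also have "\<dots> \<le> erasure_error M q f g"
      unfolding erasure_error_def using iM by (intro Max_ge) auto
    finally show ?thesis .
  qed
  ultimately show ?thesis
    using k unfolding erasure_optimal_dual_def by (meson order_trans)
qed

end
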